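(* Let $\alpha\in(0,1]$ be a real number, $a\in\mathbb{N}$, $g\in\mathbb{N}\setminus\{1\}$, and $B=\{ag^k: k\in\mathbb{N}\}$. Suppose that there exists a prime $p$ such that $p\nmid a$ and $g$ is a primitive root modulo $p^2$. Then there exists an additive complement $A\subset\mathbb{N}$ of $B$ such that $A$ can be written as a union of disjoint infinite arithmetic progressions and $d(A)=\alpha$.
   Context: $\mathbb{N}$ denotes the set of positive integers and $\mathbb{N}_0$ the set of nonnegative integers. For $A,B\subset\mathbb{N}$, $A+B=\{x+y: x\in A,\ y\in B\}$. A set $A\subset\mathbb{N}$ is an additive complement of $B\subset\mathbb{N}$ if $\mathbb{N}\setminus(A+B)$ is finite. A positive integer $x$ is a primitive root modulo $n$ if for every integer $b$ coprime to $n$ there is a positive integer $m_b$ with $x^{m_b}\equiv b\pmod n$. An infinite arithmetic progression is a set of the form $\{x+id: i\in\mathbb{N}_0\}$ with $x,d\in\mathbb{N}$. A nonempty set $A\subset\mathbb{N}$ is a union of disjoint infinite arithmetic progressions if it is the union of some (finite or infinite) family of pairwise disjoint infinite arithmetic progressions; the common differences may vary within the family. For $A\subset\mathbb{N}$, the upper and lower asymptotic densities are $\overline{d}(A)=\limsup_{n\to\infty}\frac{|A\cap[1,n]|}{n}$ and $\underline{d}(A)=\liminf_{n\to\infty}\frac{|A\cap[1,n]|}{n}$; if they are equal, the density $d(A)$ is said to exist and is their common value. The assertion $d(A)=\alpha$ means that the density exists and equals $\alpha$. *)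

theory Defs
  imports "HOL-Analysis.Analysis" "HOL-Number_Theory.Number_Theory"
begin

text \<open>
  The positive integers are the positive elements of \<^typ>\<open>nat\<close>, so subsets of them carry an
  explicit \<open>\<subseteq> {0<..}\<close>. The sumset is \<open>A + B\<close> of \<open>HOL-Library.Set_Algebras\<close>.
\<close>

definition additive_complement :: "nat set \<Rightarrow> nat set \<Rightarrow> bool" where
  "additive_complement A B \<longleftrightarrow>
     A \<subseteq> {0<..} \<and> B \<subseteq> {0<..} \<and> finite ({0<..} - (A + B))"

definition infinite_AP :: "nat set \<Rightarrow> bool" where
  "infinite_AP P \<longleftrightarrow> (\<exists>x d. x > 0 \<and> d > 0 \<and> P = {x + i * d | i. True})"

definition union_of_disjoint_APs :: "nat set \<Rightarrow> bool" where
  "union_of_disjoint_APs A \<longleftrightarrow>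
     A \<noteq> {} \<and> (\<exists>F. (\<forall>P\<in>F. infinite_AP P) \<and> pairwise disjnt F \<and> A = \<Union>F)"

definition upper_density :: "nat set \<Rightarrow> ereal" where
  "upper_density A = limsup (\<lambda>n. ereal (real (card (A \<inter> {1..n})) / real n))"

definition lower_density :: "nat set \<Rightarrow> ereal" where
  "lower_density A = liminf (\<lambda>n. ereal (real (card (A \<inter> {1..n})) / real n))"

definition has_density :: "nat set \<Rightarrow> real \<Rightarrow> bool" where
  "has_density A \<alpha> \<longleftrightarrow> upper_density A = ereal \<alpha> \<and> lower_density A = ereal \<alpha>"

text \<open>
  The library defines \<^const>\<open>residue_primroot\<close> through the order of \<open>x\<close>; this is the same as
  requiring that the powers of \<open>x\<close> represent every integer coprime to the modulus.
\<close>

lemma residue_primroot_iff_powers: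
  fixes n x :: nat
  assumes n: "n > 1"
  shows "residue_primroot n x \<longleftrightarrow>
           (\<forall>b::int. coprime b (int n) \<longrightarrow> (\<exists>m::nat. m > 0 \<and> [int x ^ m = b] (mod int n)))"
proof
  assume x: "residue_primroot n x"
  show "\<forall>b::int. coprime b (int n) \<longrightarrow> (\<exists>m::nat. m > 0 \<and> [int x ^ m = b] (mod int n))"
  proof (intro allI impI)
    fix b :: int
    assume b: "coprime b (int n)"
    define c where "c = nat (b mod int n)"
    have c: "int c = b mod int n"
      using n by (simp add: c_def)
    have "coprime (int c) (int n)"
      using b n by (simp add: c coprime_commute)
    then have cop: "coprime c n" by simp
    have "c < n" using n by (simp add: c_def nat_less_iff)
    moreover have "c \<noteq> 0" using cop n by (intro notI) simp
    ultimately have "c \<in> totatives n" using cop by (simp add: in_totatives_iff)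
    then obtain i where i: "c = x ^ i mod n"
      using residue_primroot_is_generator[OF n x] by (auto simp: bij_betw_def)
    have "[x ^ (i + totient n) = x ^ i * 1] (mod n)"
      unfolding power_add using x
      by (intro cong_mult cong_refl) (simp add: ord_divides' residue_primroot_def)
    then have "[x ^ (i + totient n) = c] (mod n)"
      by (simp add: i cong_def)
    then have "[int x ^ (i + totient n) = int c] (mod int n)"
      by (metis cong_int_iff of_nat_power)
    then have "[int x ^ (i + totient n) = b] (mod int n)"
      by (simp add: c cong_def)
    moreover have "i + totient n > 0" using n by simp
    ultimately show "\<exists>m::nat. m > 0 \<and> [int x ^ m = b] (mod int n)" by blast
  qed
next
  assume H: "\<forall>b::int. coprime b (int n) \<longrightarrow> (\<exists>m::nat. m > 0 \<and> [int x ^ m = b] (mod int n))"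
  have H': "\<exists>m>0. [x ^ m = c] (mod n)" if "coprime c n" for c
    using H[rule_format, of "int c"] that by (metis coprime_int_iff cong_int_iff of_nat_power)
  obtain m where m: "m > 0" "[x ^ m = 1] (mod n)" using H'[of 1] by auto
  then have "ord n x dvd m" by (simp add: ord_divides')
  with m have pos: "ord n x > 0" by (auto intro: Nat.gr0I)
  then have cop: "coprime n x" by simp
  have "totatives n \<subseteq> (\<lambda>i. x ^ i mod n) ` {..<ord n x}"
  proof
    fix c assume c: "c \<in> totatives n"
    then have "c < n" using n by (simp add: totatives_less)
    moreover obtain i where "[x ^ i = c] (mod n)"
      using H'[of c] c by (auto simp: in_totatives_iff)
    moreover have "[x ^ (i mod ord n x) = x ^ i] (mod n)"
      using order_divides_expdiff[OF cop, of "i mod ord n x" i] by (simp add: cong_def)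
    ultimately have "c = x ^ (i mod ord n x) mod n" by (simp add: cong_def)
    then show "c \<in> (\<lambda>i. x ^ i mod n) ` {..<ord n x}" using pos by auto
  qed
  then have "card (totatives n) \<le> card {..<ord n x}"
    by (rule surj_card_le[rotated]) simp
  then have "totient n \<le> ord n x" by (simp add: totient_def)
  moreover have "ord n x \<le> totient n"
    using order_divides_totient[OF cop] n by (intro dvd_imp_le) auto
  ultimately show "residue_primroot n x"
    using cop n by (simp add: residue_primroot_def)
qed

end

theory Submission
  imports Defs
begin

text \<open>
  The set \<open>A\<close> consists of a sparse periodic part that already is an additive complement of \<open>B\<close>,
  and of further progressions that raise the density to exactly \<open>\<alpha>\<close>.

  The sparse part exists because, if \<open>g ^ t = 1 + M\<close> with \<open>p\<^sup>2\<close> dividing \<open>M\<close>, the powers of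
  \<open>1 + M\<close> reach every residue that is not excluded by their being \<open>1\<close> modulo \<open>M\<close>: every integer
  congruent to \<open>1\<close> modulo \<open>M\<close> is congruent to one of them modulo \<open>M p\<^sup>k\<close>, for every \<open>k\<close>
  (\<open>powers_hit_principal_residues\<close>, a Hensel-type lifting in \<open>k\<close>).
  With \<open>b = a g ^ t\<close>, a subset of \<open>B\<close> therefore meets every class modulo \<open>q = b M p\<^sup>k\<close> that
  reduces to \<open>b\<close> modulo \<open>b M\<close>. The \<open>b M\<close> residue classes \<open>0, ..., b M - 1\<close> modulo \<open>q\<close>, added to
  this subset, cover all large integers (\<open>translated_powers_cover\<close>). The number \<open>b M\<close> of these
  classes does not depend on \<open>k\<close>, so their total density \<open>1 / p\<^sup>k\<close> can be made smaller
  than \<open>\<alpha>\<close>.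

  To reach the density \<open>\<alpha>\<close>, each of the remaining classes modulo \<open>q\<close> is filled to the same
  proportion \<open>\<gamma>\<close> (\<open>sparse_class_filling\<close>). The integers \<open>m\<close> of \<open>2\<close>-adic valuation \<open>i - 1\<close>, with
  \<open>i \<ge> 1\<close>, form pairwise disjoint residue classes of densities \<open>1 / 2 ^ i\<close>, so the binary
  expansion of \<open>\<gamma>\<close> says which of them to take in the quotients \<open>m\<close> of \<open>n\<close> by \<open>q\<close>. There may be
  infinitely many progressions, and densities are not countably additive in general; they are here,
  because no progression starts before its common difference (\<open>density_disjoint_APs\<close>).
\<close>

section \<open>Densities of unions of progressions\<close>

definition AP :: "nat \<Rightarrow> nat \<Rightarrow> nat set" where
  "AP x d = {x + i * d | i. True}"

text \<open>
  The upper bound has no error term because the progression starts no earlier than \<open>d\<close>; this is what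
  allows summing it over infinitely many progressions.
\<close>

lemma AP_count:
  assumes "0 < d" "d \<le> x"
  shows AP_count_upper: "real (card (AP x d \<inter> {1..n})) \<le> real n / real d"
    and AP_count_lower: "(real n - real x) / real d \<le> real (card (AP x d \<inter> {1..n}))"
proof -
  have "(real n - real x) / real d \<le> real (card (AP x d \<inter> {1..n})) \<and>
    real (card (AP x d \<inter> {1..n})) \<le> real n / real d"
  proof (cases "x \<le> n")
    case False
    then have "AP x d \<inter> {1..n} = {}" by (auto simp: AP_def)
    with False show ?thesis by (simp add: divide_nonpos_nonneg)
  next
    case True
    have "AP x d \<inter> {1..n} = (\<lambda>i. x + i * d) ` {..(n - x) div d}"
      using assms True by (auto simp: AP_def less_eq_div_iff_mult_less_eq)
    moreover have "inj_on (\<lambda>i. x + i * d) {..(n - x) div d}"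
      using assms by (auto intro: inj_onI)
    ultimately have card: "card (AP x d \<inter> {1..n}) = (n - x) div d + 1"
      by (simp add: card_image)
    have "(n - x + d) div d \<le> n div d" using assms True by (intro div_le_mono) simp
    then have "(n - x) div d + 1 \<le> n div d" using assms by simp
    then have "real ((n - x) div d + 1) \<le> real (n div d)" by (simp only: of_nat_le_iff)
    also have "\<dots> \<le> real n / real d" by (rule of_nat_div_le_of_nat)
    finally have up: "real ((n - x) div d + 1) \<le> real n / real d" .
    have "real (n - x) / real d \<le> real ((n - x) div d + 1)"
      using floor_divide_of_nat_eq[of "n - x" d, where ?'a = real] by linarith
    with up card True show ?thesis by (simp add: of_nat_diff)
  qed
  then show "real (card (AP x d \<inter> {1..n})) \<le> real n / real d"
    and "(real n - real x) / real d \<le> real (card (AP x d \<inter> {1..n}))" by auto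
qed

lemma has_densityI:
  assumes "(\<lambda>n. real (card (A \<inter> {1..n})) / real n) \<longlonglongrightarrow> \<alpha>"
  shows "has_density A \<alpha>"
  using assms unfolding has_density_def upper_density_def lower_density_def
  by (auto intro!: lim_imp_Limsup lim_imp_Liminf)

text \<open>
  The error-free upper counts add up to at most \<open>n \<alpha>\<close>. From below, finitely many of the
  progressions have a total density close to \<open>\<alpha>\<close>, and their counting errors are bounded
  independently of \<open>n\<close>.
\<close>

lemma density_disjoint_APs:
  fixes x d :: "'i \<Rightarrow> nat" and \<alpha> :: real
  assumes pos: "\<And>i. i \<in> I \<Longrightarrow> 0 < d i" and start: "\<And>i. i \<in> I \<Longrightarrow> d i \<le> x i"
    and disj: "disjoint_family_on (\<lambda>i. AP (x i) (d i)) I"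
    and sum: "((\<lambda>i. 1 / real (d i)) has_sum \<alpha>) I"
  shows "has_density (\<Union>i\<in>I. AP (x i) (d i)) \<alpha>"
proof (rule has_densityI)
  define A where "A = (\<Union>i\<in>I. AP (x i) (d i))"
  define f where "f n = real (card (A \<inter> {1..n})) / real n" for n
  have inj: "inj_on x I"
  proof (rule inj_onI, rule ccontr)
    fix i j assume ij: "i \<in> I" "j \<in> I" "x i = x j" "i \<noteq> j"
    have "x i \<in> AP (x i) (d i)" "x i \<in> AP (x j) (d j)"
      using ij(3) by (auto simp: AP_def intro: exI[of _ 0])
    then have "x i \<in> AP (x i) (d i) \<inter> AP (x j) (d j)" by simp
    moreover have "AP (x i) (d i) \<inter> AP (x j) (d j) = {}"
      using disj ij(1,2,4) unfolding disjoint_family_on_def by blast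
    ultimately show False by blast
  qed
  have upper: "f n \<le> \<alpha>" for n
  proof -
    define K where "K = {i \<in> I. x i \<le> n}"
    have "x ` K \<subseteq> {..n}" by (auto simp: K_def)
    then have fin: "finite K"
      using inj by (auto simp: K_def intro!: finite_imageD[of x] intro: finite_subset inj_on_subset)
    have "A \<inter> {1..n} = (\<Union>i\<in>K. AP (x i) (d i) \<inter> {1..n})"
      by (fastforce simp: A_def K_def AP_def)
    then have "card (A \<inter> {1..n}) \<le> (\<Sum>i\<in>K. card (AP (x i) (d i) \<inter> {1..n}))"
      using card_UN_le[OF fin] by metis
    then have "real (card (A \<inter> {1..n})) \<le> (\<Sum>i\<in>K. real (card (AP (x i) (d i) \<inter> {1..n})))"
      by (simp only: of_nat_le_iff flip: of_nat_sum)
    also have "\<dots> \<le> (\<Sum>i\<in>K. real n * (1 / real (d i)))"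
      using AP_count_upper pos start by (intro sum_mono) (auto simp: K_def)
    also have "\<dots> = real n * (\<Sum>i\<in>K. 1 / real (d i))" by (simp add: sum_distrib_left)
    also have "\<dots> \<le> real n * \<alpha>"
      using fin by (intro mult_left_mono finite_sum_le_has_sum[OF sum]) (auto simp: K_def)
    finally have le: "real (card (A \<inter> {1..n})) \<le> real n * \<alpha>" .
    have "0 \<le> \<alpha>" using sum by (rule has_sum_nonneg) simp
    with le show ?thesis by (cases "n = 0") (auto simp: f_def field_simps)
  qed
  have lower: "\<forall>\<^sub>F n in sequentially. \<alpha> - e < f n" if "e > 0" for e
  proof -
    obtain K where K: "finite K" "K \<subseteq> I" "\<alpha> - e < (\<Sum>i\<in>K. 1 / real (d i))"
    proof -
      have "\<forall>\<^sub>F K in finite_subsets_at_top I. \<alpha> - e < (\<Sum>i\<in>K. 1 / real (d i))"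
        using sum \<open>e > 0\<close> unfolding has_sum_def by (intro order_tendstoD) auto
      then show ?thesis using that unfolding eventually_finite_subsets_at_top by blast
    qed
    define S where "S = (\<Sum>i\<in>K. 1 / real (d i))"
    define C where "C = (\<Sum>i\<in>K. real (x i) / real (d i))"
    have "S - C / real n \<le> f n" if "n > 0" for n
    proof -
      have "(\<Union>i\<in>K. AP (x i) (d i) \<inter> {1..n}) \<subseteq> A \<inter> {1..n}" using K(2) by (auto simp: A_def)
      then have "card (\<Union>i\<in>K. AP (x i) (d i) \<inter> {1..n}) \<le> card (A \<inter> {1..n})"
        by (intro card_mono) auto
      moreover have "card (\<Union>i\<in>K. AP (x i) (d i) \<inter> {1..n}) = (\<Sum>i\<in>K. card (AP (x i) (d i) \<inter> {1..n}))"
        using K disj by (intro card_UN_disjoint) (auto simp: disjoint_family_on_def; blast)+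
      ultimately have "(\<Sum>i\<in>K. real (card (AP (x i) (d i) \<inter> {1..n}))) \<le> real (card (A \<inter> {1..n}))"
        by (simp only: of_nat_le_iff flip: of_nat_sum)
      moreover have "(\<Sum>i\<in>K. (real n - real (x i)) / real (d i)) \<le> (\<Sum>i\<in>K. real (card (AP (x i) (d i) \<inter> {1..n})))"
        using AP_count_lower pos start K(2) by (intro sum_mono) auto
      moreover have "(\<Sum>i\<in>K. (real n - real (x i)) / real (d i)) = real n * S - C"
        by (simp add: S_def C_def diff_divide_distrib sum_subtractf sum_distrib_left)
      ultimately have "real n * S - C \<le> real (card (A \<inter> {1..n}))" by linarith
      then have "(real n * S - C) / real n \<le> f n"
        unfolding f_def by (rule divide_right_mono) simp
      with that show ?thesis by (simp add: diff_divide_distrib)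
    qed
    then have ev: "\<forall>\<^sub>F n in sequentially. S - C / real n \<le> f n"
      by (intro eventually_sequentiallyI[of 1]) auto
    have "(\<lambda>n. S - C / real n) \<longlonglongrightarrow> S - 0"
      by (intro tendsto_diff tendsto_const lim_const_over_n)
    then have "\<forall>\<^sub>F n in sequentially. \<alpha> - e < S - C / real n"
      using K(3) by (intro order_tendstoD) (auto simp: S_def)
    with ev show ?thesis by eventually_elim simp
  qed
  have "f \<longlonglongrightarrow> \<alpha>"
  proof (rule order_tendstoI)
    fix b assume "b < \<alpha>"
    with lower[of "\<alpha> - b"] show "\<forall>\<^sub>F n in sequentially. b < f n" by simp
  next
    fix b assume "\<alpha> < b"
    with upper show "\<forall>\<^sub>F n in sequentially. f n < b"
      by (intro always_eventually allI) (rule le_less_trans)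
  qed
  then show "(\<lambda>n. real (card ((\<Union>i\<in>I. AP (x i) (d i)) \<inter> {1..n})) / real n) \<longlonglongrightarrow> \<alpha>"
    unfolding f_def A_def .
qed

section \<open>Binary expansions\<close>

lemma binary_expansion:
  fixes \<gamma> :: real
  assumes "0 < \<gamma>" "\<gamma> \<le> 1"
  obtains J :: "nat set" where "J \<subseteq> {1..}" "((\<lambda>i. 1 / 2 ^ i) has_sum \<gamma>) J"
proof -
  \<comment> \<open>The largest integer strictly below \<open>2 ^ n * \<gamma>\<close>, rather than the floor: it starts
      at \<open>f 0 = 0\<close> for \<open>\<gamma> = 1\<close> as well, and gives the expansion with infinitely many digits \<open>1\<close>.\<close>
  define f :: "nat \<Rightarrow> int" where "f n = \<lceil>2 ^ n * \<gamma>\<rceil> - 1" for n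
  define J where "J = {i \<in> {1..}. odd (f i)}"
  define t where "t i = (if i \<in> J then 1 / 2 ^ i else 0 :: real)" for i
  have f0: "f 0 = 0" using assms unfolding f_def by (simp add: ceiling_eq_iff)
  have fSuc: "f (Suc n) = 2 * f n \<or> f (Suc n) = 2 * f n + 1" for n
    proof -
    have "f (Suc n) = \<lceil>2 * (2 ^ n * \<gamma>)\<rceil> - 1" by (simp add: f_def mult.assoc)
    moreover have "f n = \<lceil>2 ^ n * \<gamma>\<rceil> - 1" by (simp add: f_def)
    ultimately show ?thesis by linarith
  qed
  have part: "(\<Sum>i<Suc n. t i) = f n / 2 ^ n" for n
  proof (induction n)
    case 0
    show ?case by (simp add: t_def J_def f0)
  next
    case (Suc n)
    have "t (Suc n) = (f (Suc n) - 2 * f n) / 2 ^ Suc n"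
      using fSuc[of n] by (auto simp: t_def J_def)
    then have "(\<Sum>i<Suc (Suc n). t i) = f n / 2 ^ n + (f (Suc n) - 2 * f n) / 2 ^ Suc n"
      using Suc.IH by simp
    also have "\<dots> = f (Suc n) / 2 ^ Suc n" by (simp add: field_simps)
    finally show ?case .
  qed
  have bounds: "\<gamma> - 1 / 2 ^ n \<le> f n / 2 ^ n" "f n / 2 ^ n \<le> \<gamma>" for n
  proof -
    have "2 ^ n * \<gamma> - 1 \<le> f n" "f n \<le> 2 ^ n * \<gamma>" unfolding f_def by linarith+
    then have "(2 ^ n * \<gamma> - 1) / 2 ^ n \<le> f n / 2 ^ n" "f n / 2 ^ n \<le> 2 ^ n * \<gamma> / 2 ^ n"
      by (intro divide_right_mono; simp)+
    then show "\<gamma> - 1 / 2 ^ n \<le> f n / 2 ^ n" "f n / 2 ^ n \<le> \<gamma>" by (simp_all add: diff_divide_distrib)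
  qed
  have "(\<lambda>n. \<gamma> - (1/2) ^ n) \<longlonglongrightarrow> \<gamma> - 0"
    by (intro tendsto_diff tendsto_const LIMSEQ_power_zero) simp
  then have lim: "(\<lambda>n. \<gamma> - (1/2) ^ n) \<longlonglongrightarrow> \<gamma>" by simp
  have "(\<lambda>n. f n / 2 ^ n) \<longlonglongrightarrow> \<gamma>"
    by (rule tendsto_sandwich[OF always_eventually always_eventually, of "\<lambda>n. \<gamma> - (1/2) ^ n" _ "\<lambda>_. \<gamma>"])
      (use bounds lim in \<open>auto simp: power_one_over\<close>)
  then have sums: "t sums \<gamma>"
    unfolding sums_def by (subst filterlim_sequentially_Suc[symmetric]) (simp only: part)
  then have "(t has_sum \<gamma>) UNIV"
    by (rule sums_nonneg_imp_has_sum) (simp add: t_def)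
  then have "((\<lambda>i. 1 / 2 ^ i) has_sum \<gamma>) J"
    by (rule has_sum_cong_neutral[THEN iffD1, rotated -1]) (auto simp: t_def)
  moreover have "J \<subseteq> {1..}" by (auto simp: J_def)
  ultimately show ?thesis using that by blast
qed

section \<open>Residues of powers\<close>

lemma one_plus_power_cong:
  fixes x :: int
  shows "[(1 + x) ^ n = 1 + int n * x] (mod x\<^sup>2)"
proof (induction n)
  case (Suc n)
  have "[(1 + x) * (1 + x) ^ n = (1 + x) * (1 + int n * x)] (mod x\<^sup>2)"
    by (intro cong_mult cong_refl Suc.IH)
  moreover have "(1 + x) * (1 + int n * x) = 1 + int (Suc n) * x + x\<^sup>2 * int n"
    by (simp add: algebra_simps power2_eq_square)
  ultimately show ?case by (simp add: cong_def)
qed simp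

text \<open>
  Raising \<open>1 + x\<close> to the power \<open>r\<close> multiplies \<open>x\<close> by \<open>r\<close> up to multiples of \<open>x\<^sup>2\<close>. The divisibility
  of \<open>M\<close> by \<open>r\<^sup>2\<close> makes these multiples vanish to the required precision for every \<open>r\<close>, even
  or composite, without a look at the binomial coefficients.
\<close>

lemma iterated_power_cong:
  fixes M :: int and r :: nat
  assumes "int r ^ 2 dvd M"
  shows "[(1 + M) ^ (r ^ k) = 1 + M * int r ^ k] (mod M * int r ^ Suc k)"
proof (induction k)
  case (Suc k)
  define R where "R = int r"
  from Suc.IH obtain w where w: "(1 + M) ^ (r ^ k) = 1 + M * R ^ k + M * R ^ Suc k * w"
    by (metis R_def cong_iff_lin cong_sym)
  define x where "x = M * R ^ k * (1 + R * w)"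
  have x: "(1 + M) ^ (r ^ k) = 1 + x" by (simp add: w x_def algebra_simps)
  obtain m where m: "M = R\<^sup>2 * m" using assms by (auto simp: R_def)
  have "x\<^sup>2 = M * R ^ Suc (Suc k) * (m * R ^ k * (1 + R * w)\<^sup>2)"
    unfolding x_def power2_eq_square by (subst (2) m) (simp add: power2_eq_square algebra_simps)
  then have "M * R ^ Suc (Suc k) dvd x\<^sup>2" by simp
  with one_plus_power_cong[of x r] have "[(1 + x) ^ r = 1 + R * x] (mod M * R ^ Suc (Suc k))"
    unfolding R_def by (rule cong_dvd_modulus)
  moreover have "1 + R * x = 1 + M * R ^ Suc k + M * R ^ Suc (Suc k) * w"
    by (simp add: x_def algebra_simps)
  then have "[1 + R * x = 1 + M * R ^ Suc k] (mod M * R ^ Suc (Suc k))"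
    unfolding cong_def by (simp only: mod_mult_self2)
  moreover have "(1 + M) ^ (r ^ Suc k) = (1 + x) ^ r"
    by (metis x power_Suc2 power_mult)
  ultimately show ?case by (metis R_def cong_trans)
qed simp

text \<open>
  The exponent is lifted digit by digit in base \<open>r\<close>: if \<open>(1 + M) ^ i\<close> exceeds \<open>c\<close> by \<open>M r\<^sup>k u\<close>, then
  adding \<open>r\<^sup>k s\<close> to \<open>i\<close> changes \<open>u\<close> to \<open>u + s\<close> modulo \<open>r\<close>, so the digit \<open>s = - u mod r\<close> corrects it.
  The bound on \<open>i\<close> bounds the powers needed to reach all residues.
\<close>

lemma powers_hit_principal_residues:
  fixes M c :: int and r :: nat
  assumes r: "r > 0" "int r ^ 2 dvd M" and c: "[c = 1] (mod M)"
  shows "\<exists>i<r ^ k. [(1 + M) ^ i = c] (mod M * int r ^ k)"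
proof (induction k)
  case 0
  then show ?case using c by (auto simp: cong_sym_eq)
next
  case (Suc k)
  define R where "R = int r"
  define Q where "Q = M * R ^ k"
  from Suc.IH obtain i u where i: "i < r ^ k" and u: "(1 + M) ^ i = c + Q * u"
    by (metis R_def Q_def cong_iff_lin cong_sym)
  obtain v where v: "c = 1 + R * v"
  proof -
    have "R dvd M" using r(2) by (metis R_def dvd_power dvd_trans zero_less_numeral)
    with c have "[c = 1] (mod R)" by (rule cong_dvd_modulus)
    then show ?thesis using that by (metis cong_iff_lin cong_sym)
  qed
  have "R dvd Q" using r(2) by (metis R_def Q_def dvd_mult2 dvd_power dvd_trans zero_less_numeral)
  then have QQ: "Q * R dvd Q\<^sup>2" by (simp add: power2_eq_square)
  define s where "s = nat ((- u) mod R)"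
  have s: "s < r" "int s = (- u) mod R" using r(1) by (auto simp: s_def R_def nat_less_iff)
  obtain w where w: "int s = - u + R * w"
    by (metis s(2) minus_mult_div_eq_mod diff_conv_add_uminus mult_minus_right)
  obtain y where y: "Q\<^sup>2 = Q * R * y" using QQ by (auto elim: dvdE)
  have "[(1 + M) ^ (r ^ k) = 1 + Q] (mod Q * R)"
    using iterated_power_cong[OF r(2), of k] by (simp add: Q_def R_def mult_ac)
  then have "[((1 + M) ^ (r ^ k)) ^ s = (1 + Q) ^ s] (mod Q * R)" by (rule cong_pow)
  also have "[(1 + Q) ^ s = 1 + int s * Q] (mod Q * R)"
    using one_plus_power_cong QQ by (rule cong_dvd_modulus)
  finally have "[(1 + M) ^ i * ((1 + M) ^ (r ^ k)) ^ s = (c + Q * u) * (1 + int s * Q)] (mod Q * R)"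
    unfolding u by (intro cong_mult cong_refl)
  also have "(c + Q * u) * (1 + int s * Q) = c + Q * (u + int s) + Q * R * (v * int s) + Q\<^sup>2 * (u * int s)"
    by (simp add: v algebra_simps power2_eq_square)
  also have "\<dots> = c + Q * R * (w + v * int s + y * u * int s)"
    unfolding w y by (simp add: algebra_simps)
  finally have "[(1 + M) ^ i * ((1 + M) ^ (r ^ k)) ^ s = c] (mod Q * R)"
    by (simp add: cong_def)
  moreover have "Q * R = M * int r ^ Suc k" by (simp add: Q_def R_def)
  ultimately have "[(1 + M) ^ (i + r ^ k * s) = c] (mod M * int r ^ Suc k)"
    by (simp only: power_add power_mult)
  moreover have "i + r ^ k * s < r ^ Suc k"
  proof -
    have "i + r ^ k * s < r ^ k * Suc s" using i by simp
    also have "\<dots> \<le> r ^ k * r" using s(1) by (intro mult_left_mono) auto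
    finally show ?thesis by (simp add: mult.commute)
  qed
  ultimately show ?case by blast
qed


text \<open>
  The residue \<open>\<rho>\<close> is chosen to make \<open>n - \<rho>\<close> congruent to \<open>a\<close> modulo \<open>a M\<close>. Then \<open>n - \<rho>\<close> is \<open>a\<close> times
  a number congruent to \<open>1\<close> modulo \<open>M\<close>, hence congruent modulo \<open>q\<close> to \<open>a\<close> times a power of \<open>1 + M\<close>.
  The size of \<open>n\<close> keeps the difference beyond the starting point of the progression.
\<close>

lemma translated_powers_cover:
  fixes a M r k n :: nat
  defines "q \<equiv> a * M * r ^ k"
  assumes pos: "a > 0" "M > 0" "r > 0" and r: "r ^ 2 dvd M"
    and large: "2 * q + a * (1 + M) ^ (r ^ k) \<le> n"
  shows "\<exists>\<rho><a * M. \<exists>y\<in>AP (\<rho> + q) q. \<exists>i. n = y + a * (1 + M) ^ i"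
proof -
  define \<rho> where "\<rho> = nat ((int n - int a) mod int (a * M))"
  have \<rho>: "\<rho> < a * M" "int \<rho> = (int n - int a) mod int (a * M)"
    using pos by (auto simp: \<rho>_def nat_less_iff simp del: of_nat_mult)
  define v where "v = (int n - int a) div int (a * M)"
  have "int (a * M) * v + int \<rho> = int n - int a"
    unfolding v_def \<rho>(2) by simp
  then have n: "int n = int \<rho> + int a * (1 + int M * v)" by (simp add: algebra_simps)
  have "int r ^ 2 dvd int M" using r by (metis of_nat_dvd_iff of_nat_power)
  moreover have "[1 + int M * v = 1] (mod int M)" by (simp add: cong_def)
  ultimately obtain i where i: "i < r ^ k"
    and "[(1 + int M) ^ i = 1 + int M * v] (mod int M * int r ^ k)"
    using powers_hit_principal_residues[OF pos(3)] by blast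
  then obtain w where w: "1 + int M * v = (1 + int M) ^ i + int M * int r ^ k * w"
    by (metis cong_iff_lin)
  have eq: "int n = int \<rho> + int q * w + int (a * (1 + M) ^ i)"
    unfolding n w by (simp add: q_def algebra_simps)
  have "a * (1 + M) ^ i \<le> a * (1 + M) ^ (r ^ k)"
    using i by (intro mult_left_mono power_increasing) auto
  with large have "2 * q + a * (1 + M) ^ i \<le> n" by linarith
  then have "int (2 * q + a * (1 + M) ^ i) \<le> int n" by (simp only: of_nat_le_iff)
  then have le: "2 * int q \<le> int \<rho> + int q * w" using eq by (simp del: of_nat_mult of_nat_power)
  have "a * M * 1 \<le> q" unfolding q_def using pos by (intro mult_left_mono) auto
  with \<rho>(1) have "int \<rho> < int q" by simp
  with le have "int q * 1 < int q * w" by linarith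
  then have "1 < w" by (rule mult_left_less_imp_less) simp
  then have "w = 1 + int (nat (w - 1))" by simp
  then obtain j where "w = 1 + int j" ..
  then have "int n = int (\<rho> + q + j * q + a * (1 + M) ^ i)"
    unfolding eq by (simp add: algebra_simps)
  then have "n = \<rho> + q + j * q + a * (1 + M) ^ i" by (simp only: of_nat_eq_iff)
  with \<rho>(1) show ?thesis by (auto simp: AP_def)
qed

section \<open>Filling residue classes to a prescribed density\<close>

text \<open>
  For \<open>s < q\<close>, a number \<open>n = s + q * m\<close> belongs to \<open>dyadic_AP q (s, i)\<close> if and only if
  \<open>m \<ge> 2 ^ i\<close> and, for \<open>i > 0\<close>, the \<open>2\<close>-adic valuation of \<open>m\<close> is \<open>i - 1\<close>. The case \<open>i = 0\<close>, where
  \<open>2 ^ i div 2 = 0\<close>, is the whole class of \<open>s\<close> from \<open>s + q\<close> on. The offset \<open>2 ^ i\<close> makes the start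
  at least as large as the common difference.
\<close>

definition dyadic_AP :: "nat \<Rightarrow> nat \<times> nat \<Rightarrow> nat set" where
  "dyadic_AP q = (\<lambda>(s, i). AP (s + q * (2 ^ i + 2 ^ i div 2)) (q * 2 ^ i))"

lemma dyadic_AP_residues:
  assumes "n \<in> dyadic_AP q (s, i)" "s < q"
  shows "n mod q = s" "(n div q) mod 2 ^ i = 2 ^ i div 2"
proof -
  obtain k where "n = s + q * (2 ^ i + 2 ^ i div 2) + k * (q * 2 ^ i)"
    using assms by (auto simp: dyadic_AP_def AP_def)
  then have n: "n = s + q * (2 ^ i div 2 + 2 ^ i * (1 + k))" by (simp add: algebra_simps)
  show "n mod q = s" using assms(2) unfolding n by simp
  have "n div q = 2 ^ i div 2 + 2 ^ i * (1 + k)" using assms(2) unfolding n by simp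
  then show "(n div q) mod 2 ^ i = 2 ^ i div 2" by (simp only: mod_mult_self2) simp
qed

text \<open>Both congruences would determine the \<open>2\<close>-adic valuation of \<open>m\<close>, as \<open>i - 1\<close> and as \<open>j - 1\<close>.\<close>

lemma half_power_residues_disjoint:
  fixes m i j :: nat
  assumes "m mod 2 ^ i = 2 ^ i div 2" "m mod 2 ^ j = 2 ^ j div 2" "0 < i" "i < j"
  shows False
proof -
  have "m mod 2 ^ j mod 2 ^ i = m mod 2 ^ i"
    using assms(4) by (simp add: mod_mod_cancel le_imp_power_dvd)
  moreover have "(2::nat) ^ i dvd 2 ^ j div 2"
    using assms(4) by (cases j) (auto intro: le_imp_power_dvd)
  ultimately have "(2::nat) ^ i div 2 = 0" using assms(1,2) by simp
  with assms(3) show False by (cases i) auto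
qed

text \<open>
  The first \<open>L\<close> classes modulo \<open>q\<close> are taken whole. Every other class receives the proportion \<open>\<gamma>\<close>
  that solves \<open>L / q + (1 - L / q) * \<gamma> = \<alpha>\<close>.
\<close>

lemma sparse_class_filling:
  fixes L q :: nat and \<alpha> :: real
  assumes L: "L < q" and \<alpha>: "real L / real q < \<alpha>" "\<alpha> \<le> 1"
  obtains I where "disjoint_family_on (dyadic_AP q) I"
    and "has_density (\<Union>z\<in>I. dyadic_AP q z) \<alpha>"
    and "\<And>s. s < L \<Longrightarrow> AP (s + q) q \<subseteq> (\<Union>z\<in>I. dyadic_AP q z)"
proof -
  define \<gamma> where "\<gamma> = (\<alpha> * real q - real L) / (real q - real L)"
  have \<gamma>: "0 < \<gamma>" "\<gamma> \<le> 1" using L \<alpha> by (auto simp: \<gamma>_def field_simps)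
  then obtain J where J: "J \<subseteq> {1..}" "((\<lambda>i. 1 / 2 ^ i) has_sum \<gamma>) J"
    by (rule binary_expansion)
  define I where "I = Sigma {..<q} (\<lambda>s. if s < L then {0} else J)"
  have disj: "disjoint_family_on (dyadic_AP q) I"
    unfolding disjoint_family_on_def
  proof (intro ballI impI equals0I)
    fix z z' n assume z: "z \<in> I" "z' \<in> I" "z \<noteq> z'" "n \<in> dyadic_AP q z \<inter> dyadic_AP q z'"
    obtain s i s' i' where [simp]: "z = (s, i)" "z' = (s', i')" by fastforce
    have s: "s < q" "s' < q" using z by (auto simp: I_def)
    note res = dyadic_AP_residues[of n q s i] dyadic_AP_residues[of n q s' i']
    have [simp]: "s' = s" using res s z(4) by simp
    have "i \<noteq> i'" "i > 0" "i' > 0" using z J(1) by (auto simp: I_def split: if_splits)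
    moreover have "(n div q) mod 2 ^ i = 2 ^ i div 2" "(n div q) mod 2 ^ i' = 2 ^ i' div 2"
      using res s z(4) by auto
    ultimately show False
      using half_power_residues_disjoint by (metis nat_neq_iff)
  qed
  define g where "g s = (if s < L then 1 / real q else \<gamma> / real q)" for s :: nat
  have inner: "((\<lambda>i. 1 / real (q * 2 ^ i)) has_sum g s) (if s < L then {0} else J)" for s
  proof (cases "s < L")
    case True
    then show ?thesis by (auto simp: g_def intro: has_sum_finiteI)
  next
    case False
    have "((\<lambda>i. (1 / 2 ^ i) * (1 / real q)) has_sum (\<gamma> * (1 / real q))) J"
      by (rule has_sum_cmult_left[OF J(2)])
    with False show ?thesis by (simp add: g_def mult.commute)
  qed
  have "(\<Sum>s<q. g s) = (\<Sum>s<L. g s) + (\<Sum>s=L..<q. g s)"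
    using L by (simp add: lessThan_atLeast0 sum.atLeastLessThan_concat)
  also have "\<dots> = real L / real q + (real q - real L) * (\<gamma> / real q)"
    using L by (simp add: g_def of_nat_diff)
  also have "\<dots> = \<alpha>" using L by (simp add: \<gamma>_def field_simps)
  finally have outer: "(g has_sum \<alpha>) {..<q}" by (intro has_sum_finiteI) auto
  have "((\<lambda>z. 1 / real (q * 2 ^ snd z)) has_sum \<alpha>) I"
    unfolding I_def
  proof (rule has_sum_SigmaI)
    show "(\<lambda>z. 1 / real (q * 2 ^ snd z)) summable_on Sigma {..<q} (\<lambda>s. if s < L then {0} else J)"
      by (rule summable_on_SigmaI[where g = g]) (use inner in \<open>auto simp del: of_nat_mult\<close>)
  qed (use inner outer in auto)
  then have "has_density (\<Union>z\<in>I. AP (fst z + q * (2 ^ snd z + 2 ^ snd z div 2)) (q * 2 ^ snd z)) \<alpha>"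
    using L disj unfolding dyadic_AP_def case_prod_beta
    by (intro density_disjoint_APs) (auto simp: distrib_left)
  then have dens: "has_density (\<Union>z\<in>I. dyadic_AP q z) \<alpha>"
    by (simp add: dyadic_AP_def case_prod_beta)
  have "AP (s + q) q \<subseteq> (\<Union>z\<in>I. dyadic_AP q z)" if "s < L" for s
    using that L by (intro UN_upper[of "(s, 0)", THEN subset_trans[rotated]])
      (auto simp: I_def dyadic_AP_def)
  with disj dens that show thesis by blast
qed

section \<open>Additive complements of geometric progressions\<close>

theorem theorem2p6:
  fixes \<alpha> :: real and a g :: nat and B :: "nat set"
  assumes "0 < \<alpha>" and "\<alpha> \<le> 1"
    and "a > 0" and "g > 0" and "g \<noteq> 1"
    and "B = {a * g ^ k | k. k > 0}"
    and "\<exists>p::nat. prime p \<and> \<not> p dvd a \<and> residue_primroot (p ^ 2) g"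
  shows "\<exists>A. additive_complement A B \<and> union_of_disjoint_APs A \<and> has_density A \<alpha>"
proof -
  obtain p where p: "prime p" "residue_primroot (p ^ 2) g" using assms(7) by blast
  have p1: "p > 1" using p(1) by (rule prime_gt_1_nat)
  define t where "t = totient (p ^ 2)"
  define M where "M = g ^ t - 1"
  have t: "t > 0" using p1 by (simp add: t_def)
  have "g ^ t > 1" using t assms(4,5) by (intro one_less_power) auto
  then have M: "M > 0" "g ^ t = 1 + M" by (auto simp: M_def)
  have "coprime g (p ^ 2)" using p(2) by (simp add: residue_primroot_def coprime_commute)
  then have "[g ^ t = 1] (mod p ^ 2)" unfolding t_def by (rule euler_theorem)
  then have pM: "p ^ 2 dvd M" unfolding M_def by (rule cong_to_1_nat)
  \<comment> \<open>The extra factor \<open>g ^ t\<close> keeps the exponents of \<open>g\<close> positive, as \<open>B\<close> demands, when the power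
      of \<open>1 + M\<close> has exponent \<open>0\<close>.\<close>
  define b where "b = a * g ^ t"
  have b: "b > 0" using assms(3,4) by (simp add: b_def)
  have B_mem: "b * (1 + M) ^ i \<in> B" for i
  proof -
    have "b * (1 + M) ^ i = a * g ^ (t + t * i)"
      by (simp only: b_def M(2)[symmetric] power_mult power_add mult.assoc)
    moreover have "t + t * i > 0" using t by simp
    ultimately show ?thesis unfolding assms(6) by blast
  qed
  obtain k where k: "(1 / real p) ^ k < \<alpha>"
    using real_arch_pow_inv[of \<alpha> "1 / real p"] assms(1) p1 by force
  \<comment> \<open>Passing to \<open>Suc k\<close> ensures \<open>L < q\<close>, which would fail for \<open>k = 0\<close>.\<close>
  have "(1 / real p) ^ Suc k \<le> (1 / real p) ^ k" using p1 by (intro power_decreasing) auto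
  with k have k: "(1 / real p) ^ Suc k < \<alpha>" by simp
  define L where "L = b * M"
  define q where "q = b * M * p ^ Suc k"
  have L: "0 < L" "L < q"
    using b M p1 one_less_power[OF p1, of "Suc k"] by (auto simp: L_def q_def)
  have "real L / real q = (1 / real p) ^ Suc k"
    using b M p1 by (simp add: L_def q_def power_one_over field_simps)
  with k have "real L / real q < \<alpha>" by simp
  with L(2) obtain I where I: "disjoint_family_on (dyadic_AP q) I"
    "has_density (\<Union>z\<in>I. dyadic_AP q z) \<alpha>"
    "\<And>s. s < L \<Longrightarrow> AP (s + q) q \<subseteq> (\<Union>z\<in>I. dyadic_AP q z)"
    using sparse_class_filling assms(2) by metis
  define A where "A = (\<Union>z\<in>I. dyadic_AP q z)"
  have AP: "infinite_AP (dyadic_AP q z)" for z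
    using L(2) unfolding infinite_AP_def dyadic_AP_def AP_def case_prod_beta
    by (intro exI conjI) auto
  have "dyadic_AP q z \<subseteq> {0<..}" for z
    using AP[of z] unfolding infinite_AP_def by auto
  then have A_pos: "A \<subseteq> {0<..}" unfolding A_def by blast
  have "union_of_disjoint_APs A"
    unfolding union_of_disjoint_APs_def
  proof (intro conjI exI)
    have "0 + q \<in> AP (0 + q) q" unfolding AP_def by (intro CollectI exI[of _ 0]) simp
    then show "A \<noteq> {}" using I(3)[OF L(1)] unfolding A_def by blast
    show "\<forall>P\<in>dyadic_AP q ` I. infinite_AP P" using AP by blast
    show "pairwise disjnt (dyadic_AP q ` I)"
      using I(1) by (fastforce simp: pairwise_def disjnt_def disjoint_family_on_def)
    show "A = \<Union> (dyadic_AP q ` I)" by (simp add: A_def)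
  qed
  moreover have "additive_complement A B"
    unfolding additive_complement_def
  proof (intro conjI A_pos)
    show "B \<subseteq> {0<..}" using assms(3,4,6) by auto
    have "n \<in> A + B" if "2 * q + b * (1 + M) ^ (p ^ Suc k) \<le> n" for n
    proof -
      have "p > 0" using p1 by simp
      from translated_powers_cover[OF b M(1) this pM that[unfolded q_def]]
      obtain \<rho> y i where "\<rho> < L" "y \<in> AP (\<rho> + q) q" "n = y + b * (1 + M) ^ i"
        unfolding q_def L_def by blast
      with I(3) B_mem show ?thesis unfolding A_def by blast
    qed
    then have "{0<..} - (A + B) \<subseteq> {..2 * q + b * (1 + M) ^ (p ^ Suc k)}"
      by (meson DiffE atMost_iff le_cases subsetI)
    then show "finite ({0<..} - (A + B))" by (rule finite_subset) simp
  qed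
  ultimately show ?thesis using I(2) unfolding A_def by blast
qed

end
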